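(* Let $m\ge2$ and let $(A,B,c)$ be a constant-free triplet over $\mathbb{C}$ (i.e. $a_{i,1}=b_{i,1}=0$ for all $i$) with $a_{1,2}=b_{1,2}=1$ and $a_{2,3}=b_{2,3}=1$, and let $p$ be its associated polynomial. Let $\alpha\in\mathbb{C}$ and put $$s=-\alpha^2+\alpha(b_{2,2}-a_{2,2}).$$ Let $(\hat A,\hat B,\hat c)$ be the triplet obtained from $(A,B,c)$ by setting $$\hat a_{2,2}=a_{2,2}+\alpha,\qquad \hat b_{2,2}=b_{2,2}-\alpha,$$ $$\hat a_{i,3}=a_{i,3}-s\,a_{i,4},\qquad \hat b_{i,3}=b_{i,3}-s\,b_{i,4}\qquad (i=3,\dots,m),$$ $$\hat c_3=c_3-s\,c_4,$$ with all other entries of $\hat A,\hat B,\hat c$ equal to the corresponding entries of $A,B,c$. Then the polynomial $\hat p$ associated with $(\hat A,\hat B,\hat c)$ satisfies $\hat p=p$.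
   Context: Evaluation scheme. A triplet $(A,B,c)$ (for $m$ multiplications) consists of scalars $a_{i,j},b_{i,j}\in\mathbb{C}$ for $1\le i\le m$, $1\le j\le i+1$ (the entries of $m\times(m+1)$ lower Hessenberg matrices $A,B$; entries with $j>i+1$ are zero), and a vector $c=(c_1,\dots,c_{m+2})\in\mathbb{C}^{m+2}$. The associated polynomial is $p=\sum_{j=1}^{m+2}c_jQ_j\in\mathbb{C}[x]$, where $Q_1=1$, $Q_2=x$, and for $i=1,\dots,m$ $$Q_{i+2}=\Big(\sum_{j=1}^{i+1}a_{i,j}Q_j\Big)\Big(\sum_{j=1}^{i+1}b_{i,j}Q_j\Big).$$ *)

theory Defs
  imports Complex_Main "HOL-Computational_Algebra.Polynomial"
begin

text \<open>Matrices and vectors are functions on 1-based indices, zero off the index range: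
  \<open>A i j\<close> and \<open>B i j\<close> for \<open>1 \<le> i \<le> m\<close>, \<open>1 \<le> j \<le> i + 1\<close> and \<open>c j\<close> for \<open>1 \<le> j \<le> m + 2\<close>.\<close>

definition lower_hessenberg :: "nat \<Rightarrow> (nat \<Rightarrow> nat \<Rightarrow> complex) \<Rightarrow> bool" where
  "lower_hessenberg m A \<longleftrightarrow>
     (\<forall>i j. \<not> (1 \<le> i \<and> i \<le> m \<and> 1 \<le> j \<and> j \<le> i + 1) \<longrightarrow> A i j = 0)"

definition triplet ::
  "nat \<Rightarrow> (nat \<Rightarrow> nat \<Rightarrow> complex) \<Rightarrow> (nat \<Rightarrow> nat \<Rightarrow> complex) \<Rightarrow> (nat \<Rightarrow> complex) \<Rightarrow> bool" where
  "triplet m A B c \<longleftrightarrow>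
     lower_hessenberg m A \<and> lower_hessenberg m B \<and>
     (\<forall>j. \<not> (1 \<le> j \<and> j \<le> m + 2) \<longrightarrow> c j = 0)"

definition constant_free ::
  "nat \<Rightarrow> (nat \<Rightarrow> nat \<Rightarrow> complex) \<Rightarrow> (nat \<Rightarrow> nat \<Rightarrow> complex) \<Rightarrow> bool" where
  "constant_free m A B \<longleftrightarrow> (\<forall>i\<in>{1..m}. A i 1 = 0 \<and> B i 1 = 0)"

text \<open>The index 0 is unused, its value is a dummy.  The last equation is the recursion for
  \<open>Q\<^sub>i\<^sub>+\<^sub>2\<close> with \<open>i = Suc k\<close>; see \<open>Q_step\<close> below.\<close>

fun Q :: "(nat \<Rightarrow> nat \<Rightarrow> complex) \<Rightarrow> (nat \<Rightarrow> nat \<Rightarrow> complex) \<Rightarrow> nat \<Rightarrow> complex poly" where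
  "Q A B 0 = 0"
| "Q A B (Suc 0) = 1"
| "Q A B (Suc (Suc 0)) = [:0, 1:]"
| "Q A B (Suc (Suc (Suc k))) =
     (\<Sum>j = 1..Suc (Suc k). smult (A (Suc k) j) (Q A B j)) *
     (\<Sum>j = 1..Suc (Suc k). smult (B (Suc k) j) (Q A B j))"

lemma Q_step:
  assumes "1 \<le> i"
  shows "Q A B (i + 2) =
    (\<Sum>j = 1..i + 1. smult (A i j) (Q A B j)) * (\<Sum>j = 1..i + 1. smult (B i j) (Q A B j))"
  using assms by (cases i) (simp_all del: sum.cl_ivl_Suc)

definition assoc_poly ::
  "nat \<Rightarrow> (nat \<Rightarrow> nat \<Rightarrow> complex) \<Rightarrow> (nat \<Rightarrow> nat \<Rightarrow> complex) \<Rightarrow> (nat \<Rightarrow> complex) \<Rightarrow> complex poly" where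
  "assoc_poly m A B c = (\<Sum>j = 1..m + 2. smult (c j) (Q A B j))"

text \<open>The hatted matrices are \<open>hat_mat m \<alpha> s A\<close> and \<open>hat_mat m (- \<alpha>) s B\<close>.\<close>

definition hat_mat ::
  "nat \<Rightarrow> complex \<Rightarrow> complex \<Rightarrow> (nat \<Rightarrow> nat \<Rightarrow> complex) \<Rightarrow> nat \<Rightarrow> nat \<Rightarrow> complex" where
  "hat_mat m \<delta> s A i j =
     (if i = 2 \<and> j = 2 then A 2 2 + \<delta>
      else if 3 \<le> i \<and> i \<le> m \<and> j = 3 then A i 3 - s * A i 4
      else A i j)"

definition hat_vec :: "complex \<Rightarrow> (nat \<Rightarrow> complex) \<Rightarrow> nat \<Rightarrow> complex" where
  "hat_vec s c j = (if j = 3 then c 3 - s * c 4 else c j)"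

lemma triplet_hat:
  assumes "2 \<le> m" "triplet m A B c"
  shows "triplet m (hat_mat m \<alpha> s A) (hat_mat m \<beta> s B) (hat_vec s c)"
  using assms by (auto simp: triplet_def lower_hessenberg_def hat_mat_def hat_vec_def)

end

theory Submission imports Defs begin

text \<open>Moving \<open>\<alpha>\<close> between the two factors of \<open>Q\<^sub>4\<close> changes it by \<open>s Q\<^sub>3\<close> only, because
  \<open>Q\<^sub>3 = x\<^sup>2\<close>. Replacing the coefficient of \<open>Q\<^sub>3\<close> by itself minus \<open>s\<close> times the coefficient of
  \<open>Q\<^sub>4\<close> undoes this change in every later linear combination, so all other \<open>Q\<^sub>j\<close> stay the same.\<close>

lemma sum_hat_vec:
  fixes P P' :: "nat \<Rightarrow> complex poly"
  assumes "4 \<le> n"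
    and P'_4: "P' 4 = P 4 + smult s (P 3)"
    and P'_eq: "\<And>j. j \<in> {1..n} \<Longrightarrow> j \<noteq> 4 \<Longrightarrow> P' j = P j"
  shows "(\<Sum>j = 1..n. smult (hat_vec s v j) (P' j)) = (\<Sum>j = 1..n. smult (v j) (P j))"
proof -
  have split: "{1..n} = insert 3 (insert 4 ({1..n} - {3, 4}))"
    using assms(1) by auto
  have rest: "(\<Sum>j \<in> {1..n} - {3, 4}. smult (hat_vec s v j) (P' j)) =
      (\<Sum>j \<in> {1..n} - {3, 4}. smult (v j) (P j))"
    by (rule sum.cong) (auto simp: hat_vec_def P'_eq)
  have "P' 3 = P 3"
    using assms(1) by (intro P'_eq) auto
  \<comment> \<open>The multiple \<open>s * v 4\<close> of \<open>P 3\<close> is subtracted by the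
    term at 3 and added back by the term at 4.\<close>
  then have two: "smult (hat_vec s v 3) (P' 3) + smult (hat_vec s v 4) (P' 4) =
      smult (v 3) (P 3) + smult (v 4) (P 4)"
    by (simp add: hat_vec_def P'_4 smult_add_right smult_diff_left mult.commute)
  have "(\<Sum>j = 1..n. f j) = f 3 + f 4 + (\<Sum>j \<in> {1..n} - {3, 4}. f j)"
    for f :: "nat \<Rightarrow> complex poly"
    by (subst split) (simp add: add.assoc)
  then show ?thesis
    by (simp only: rest two)
qed

text \<open>From row 3 on, hatting a matrix acts on its row exactly as hatting acts on
  \<open>c\<close>, so \<open>sum_hat_vec\<close> serves for both factors of a product as well as
  for the final sum.\<close>

lemma hat_mat_row:
  assumes "3 \<le> i" "i \<le> m"
  shows "hat_mat m \<delta> s A i = hat_vec s (A i)"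
  using assms by (auto simp: hat_mat_def hat_vec_def)

lemma Q_3:
  assumes "A 1 1 = 0" "B 1 1 = 0" "A 1 2 = 1" "B 1 2 = 1"
  shows "Q A B 3 = [:0, 0, 1:]"
  using assms by (simp add: numeral_eq_Suc)

lemma Q_4:
  assumes "A 1 1 = 0" "B 1 1 = 0" "A 1 2 = 1" "B 1 2 = 1"
    and "A 2 1 = 0" "B 2 1 = 0" "A 2 3 = 1" "B 2 3 = 1"
  shows "Q A B 4 = [:0, A 2 2, 1:] * [:0, B 2 2, 1:]"
proof -
  have "Q A B 2 = [:0, 1:]"
    by (simp add: numeral_2_eq_2)
  moreover have "{1..2 + 1} = {1, 2, 3 :: nat}"
    by auto
  ultimately show ?thesis
    using Q_step[of 2 A B] Q_3[of A B] assms by simp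
qed

text \<open>Row \<open>i\<close> determines the polynomial with index \<open>i + 2\<close>, and
  \<open>hat_mat_row\<close> covers \<open>i \<le> m\<close>; hence the bound
  \<open>j \<le> m + 2\<close>.\<close>

lemma Q_hat_mat:
  fixes A B :: "nat \<Rightarrow> nat \<Rightarrow> complex" and \<alpha> s :: complex
  assumes "2 \<le> m" "constant_free m A B"
    and "A 1 2 = 1" "B 1 2 = 1" "A 2 3 = 1" "B 2 3 = 1"
    and s: "s = - (\<alpha>\<^sup>2) + \<alpha> * (B 2 2 - A 2 2)"
  defines "A' \<equiv> hat_mat m \<alpha> s A" and "B' \<equiv> hat_mat m (- \<alpha>) s B"
  shows "Q A' B' 4 = Q A B 4 + smult s (Q A B 3)"
    and "j \<le> m + 2 \<Longrightarrow> j \<noteq> 4 \<Longrightarrow> Q A' B' j = Q A B j"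
proof -
  have zeros: "A 1 1 = 0" "B 1 1 = 0" "A 2 1 = 0" "B 2 1 = 0"
    using assms(1,2) by (auto simp: constant_free_def)
  have zeros': "A' 1 1 = 0" "B' 1 1 = 0" "A' 2 1 = 0" "B' 2 1 = 0"
    and ones': "A' 1 2 = 1" "B' 1 2 = 1" "A' 2 3 = 1" "B' 2 3 = 1"
    and shift: "A' 2 2 = A 2 2 + \<alpha>" "B' 2 2 = B 2 2 - \<alpha>"
    using zeros assms(3-6) by (simp_all add: A'_def B'_def hat_mat_def)
  have Q3: "Q A' B' 3 = [:0, 0, 1:]" "Q A B 3 = [:0, 0, 1:]"
    using Q_3 zeros zeros' ones' assms(3-6) by blast+
  \<comment> \<open>With a = \<open>A 2 2\<close> and b = \<open>B 2 2\<close>, the opposite shifts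
    keep the sum a + b, while (a + \<alpha>)(b - \<alpha>) = ab + s. The common factor x^2 of the
    product is \<open>Q A B 3\<close>.\<close>
  show Q4: "Q A' B' 4 = Q A B 4 + smult s (Q A B 3)"
    unfolding Q3 Q_4[OF zeros(1,2) assms(3,4) zeros(3,4) assms(5,6)]
      Q_4[OF zeros'(1,2) ones'(1,2) zeros'(3,4) ones'(3,4)] shift s
    by (simp add: algebra_simps power2_eq_square)
  show "j \<le> m + 2 \<Longrightarrow> j \<noteq> 4 \<Longrightarrow> Q A' B' j = Q A B j" for j
  proof (induction j rule: less_induct)
    case (less j)
    \<comment> \<open>The altered rows start at row 2, which first enters at index 4, so indices up
      to 3 are base cases.\<close>
    consider "j = 0" | "j = 1" | "j = 2" | "j = 3" | "5 \<le> j"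
      using less.prems by linarith
    then show ?case
    proof cases
      case 5
      define i where "i = j - 2"
      have i: "3 \<le> i" "i \<le> m" "j = i + 2"
        using 5 less.prems by (auto simp: i_def)
      have IH: "Q A' B' k = Q A B k" if "k \<in> {1..i + 1}" "k \<noteq> 4" for k
        using less i that by simp
      \<comment> \<open>Index 4, missing from \<open>IH\<close>, is supplied by \<open>Q4\<close>;
        \<open>3 \<le> i\<close> puts it in the range of summation. Here \<open>v\<close> will be a
        row of \<open>A\<close> or of \<open>B\<close>.\<close>
      have comb: "(\<Sum>k = 1..i + 1. smult (hat_vec s v k) (Q A' B' k)) =
          (\<Sum>k = 1..i + 1. smult (v k) (Q A B k))" for v
        using i by (intro sum_hat_vec Q4 IH) auto
      have "A' i = hat_vec s (A i)" "B' i = hat_vec s (B i)"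
        using i by (simp_all add: A'_def B'_def hat_mat_row)
      moreover have "1 \<le> i"
        using i by simp
      ultimately show ?thesis
        unfolding i(3) Q_step[OF \<open>1 \<le> i\<close>] by (simp only: comb)
    qed (simp_all add: Q3 numeral_2_eq_2)
  qed
qed

theorem theorem3p7:
  fixes m :: nat
    and A B :: "nat \<Rightarrow> nat \<Rightarrow> complex"
    and c :: "nat \<Rightarrow> complex"
    and \<alpha> s :: complex
  assumes "2 \<le> m"
    and "triplet m A B c"
    and "constant_free m A B"
    and "A 1 2 = 1" and "B 1 2 = 1"
    and "A 2 3 = 1" and "B 2 3 = 1"
    and "s = - (\<alpha>\<^sup>2) + \<alpha> * (B 2 2 - A 2 2)"
  shows "assoc_poly m (hat_mat m \<alpha> s A) (hat_mat m (- \<alpha>) s B) (hat_vec s c) = assoc_poly m A B c"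
  unfolding assoc_poly_def
  \<comment> \<open>The same cancellation, now with \<open>v = c\<close> and
    \<open>n = m + 2\<close>; \<open>2 \<le> m\<close> gives \<open>4 \<le> n\<close>.\<close>
  using assms by (intro sum_hat_vec Q_hat_mat) auto

end
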